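(* Let $\epsilon>0$ and consider the algorithm with exact searches: given $\theta_{k-1}\in\Theta\cap\mathbb{V}$, let $\tau_{k-1}$ be a maximizer of $\tau\mapsto DL(\theta_{k-1},V_\tau)$ over $\tau\ge0$, and $\theta_k:=\operatorname{argsup}_{\theta\in\Theta\cap\mathbb{V}_{D(\theta_{k-1})\cup\{\tau_{k-1}\}}}L(\theta)$. Let $R:=L(\theta_{k-1})$ (assumed finite), let $s_R\ge 0$ and $m_R<\beta$ be constants such that every $\varphi\in\Theta$ with $L(\varphi)\ge R$ satisfies $|\varphi(0)|\le s_R$ and $\sup_x\varphi'(x+)\le m_R$, and let $\gamma:=\int_0^\infty(x^2+x_n^2)e^{s_R+m_Rx}M(dx)$. If $\sup_\tau DL(\theta_{k-1},V_\tau)\ge\epsilon$, then \[L(\theta_k)-L(\theta_{k-1})\ge\frac{\epsilon^2}{2\gamma}.\]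
   Context: Let $f$ be a probability density on $\mathbb{R}_{\ge0}$ satisfying the standing assumptions: (A1) $f$ is continuous and $f(x)>0$ for all $x>0$; (A2) there is $\beta\in\mathbb{R}$ such that for every $\lambda\in\mathbb{R}$, $\int_0^\infty e^{\lambda x}f(x)\,dx<\infty$ if and only if $\lambda<\beta$, and $\lim_{\lambda\to\beta^-}\int_0^\infty e^{\lambda x}f(x)\,dx=\infty$; (A3) for every $\lambda\in\mathbb{R}$, $\int_0^\infty e^{\lambda x}f(x)dx<\infty$ implies $\int_0^\infty x^2e^{\lambda x}f(x)dx<\infty$. Let $M$ be the measure on $\mathbb{R}_{\ge0}$ with density $f$. Fix data $x_1\le\dots\le x_n$ in $\mathbb{R}_{\ge0}$ with empirical distribution $\hat P=\frac1n\sum_{i=1}^n\delta_{x_i}$. $\Theta$ is the set of convex non-decreasing functions $\theta:\mathbb{R}_{\ge0}\to\mathbb{R}$. For $\theta\in\Theta$, $L(\theta):=\int\theta\,d\hat P-\int e^{\theta}\,dM+1\in[-\infty,\infty)$. For $\theta\in\Theta$ and a function $v$, $DL(\theta,v):=\lim_{t\to0^+}\frac{L(\theta+tv)-L(\theta)}{t}$. $\mathbb{V}$ is the set of continuous piecewise linear functions $v:\mathbb{R}_{\ge0}\to\mathbb{R}$ with finitely many breakpoints; $D(v)=\{\tau\ge0: v'(\tau-)\neq v'(\tau+)\}$ is its set of breakpoints; for finite $S\subset\mathbb{R}_{\ge0}$, $\mathbb{V}_S=\{v\in\mathbb{V}:D(v)\subseteq S\}$. For $\tau\ge0$, $V_\tau(x):=(x-\tau)^+$.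 *)

theory Defs
  imports "HOL-Analysis.Analysis" "HOL-Probability.Probability"
begin

definition dens_measure :: "(real \<Rightarrow> real) \<Rightarrow> real measure" where
  "dens_measure f = density lborel (\<lambda>x. ennreal (indicator {0..} x * f x))"

definition Theta :: "(real \<Rightarrow> real) set" where
  "Theta = {\<theta>. convex_on {0..} \<theta> \<and> mono_on {0..} \<theta>}"

definition right_deriv :: "(real \<Rightarrow> real) \<Rightarrow> real \<Rightarrow> real" where
  "right_deriv v x = Lim (at_right x) (\<lambda>y. (v y - v x) / (y - x))"

definition left_deriv :: "(real \<Rightarrow> real) \<Rightarrow> real \<Rightarrow> real" where
  "left_deriv v x = Lim (at_left x) (\<lambda>y. (v y - v x) / (y - x))"

definition PL :: "(real \<Rightarrow> real) set" where
  "PL = {v. continuous_on {0..} v \<and>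
     (\<exists>S. finite S \<and> S \<subseteq> {0..} \<and>
        (\<forall>x y. 0 \<le> x \<and> x < y \<and> {x<..<y} \<inter> S = {} \<longrightarrow>
           (\<forall>z\<in>{x..y}. v z = v x + (v y - v x) / (y - x) * (z - x))))}"

text \<open>Breakpoints (the point 0 is never counted as a breakpoint, since the
  left derivative at 0 is not defined for functions on [0,inf)).\<close>
definition breakpoints :: "(real \<Rightarrow> real) \<Rightarrow> real set" where
  "breakpoints v = {\<tau>. \<tau> > 0 \<and> left_deriv v \<tau> \<noteq> right_deriv v \<tau>}"

definition PL_on :: "real set \<Rightarrow> (real \<Rightarrow> real) set" where
  "PL_on S = {v \<in> PL. breakpoints v \<subseteq> S}"

definition hinge :: "real \<Rightarrow> real \<Rightarrow> real" where
  "hinge \<tau> x = max (x - \<tau>) 0"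

text \<open>The objective L (data given as a list xs, empirical measure = uniform on xs).\<close>
definition Lobj :: "(real \<Rightarrow> real) \<Rightarrow> real list \<Rightarrow> (real \<Rightarrow> real) \<Rightarrow> ereal" where
  "Lobj f xs \<theta> = ereal (sum_list (map \<theta> xs) / real (length xs))
      - enn2ereal (\<integral>\<^sup>+ x. ennreal (exp (\<theta> x)) \<partial>dens_measure f) + 1"

definition DL :: "(real \<Rightarrow> real) \<Rightarrow> real list \<Rightarrow> (real \<Rightarrow> real) \<Rightarrow> (real \<Rightarrow> real) \<Rightarrow> ereal" where
  "DL f xs \<theta> v = Lim (at_right 0)
      (\<lambda>t. (Lobj f xs (\<lambda>x. \<theta> x + t * v x) - Lobj f xs \<theta>) / ereal t)"

end

theory Submission
  imports Defs
begin

text \<open>Along the ray \<open>t \<mapsto> \<theta> + t V\<^sub>\<tau>\<close> the objective is a real function \<open>g(t)\<close> with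
  \<open>g'(0+) = D := DL(\<theta>, V\<^sub>\<tau>) \<ge> \<epsilon>\<close>. While \<open>\<theta> + t V\<^sub>\<tau>\<close> stays in the superlevel set
  \<open>{\<phi>. L \<phi> \<ge> L \<theta>}\<close>, the hypothesis on \<open>s\<^sub>R, m\<^sub>R\<close> bounds it by \<open>s\<^sub>R + m\<^sub>R x\<close> (a convex function lies
  below its value at 0 plus its largest slope times x), and since \<open>0 \<le> V\<^sub>\<tau>(x) \<le> x\<close> the
  bound \<open>e\<^sup>b \<le> 1 + b + b\<^sup>2 e\<^sup>b / 2\<close> gives \<open>g(t) \<ge> g(0) + t D - t\<^sup>2 \<gamma> / 2\<close>. The ray does stay
  in the superlevel set up to \<open>t = D / \<gamma>\<close>: near any point where it does, the slightly larger
  envelope \<open>exp (s\<^sub>R + (m\<^sub>R + \<delta>) x)\<close>, still integrable because \<open>m\<^sub>R < \<beta>\<close>, makes \<open>g\<close> Lipschitz from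
  the right, and the quadratic bound leaves a uniform margin. At \<open>t = D / \<gamma>\<close> we get
  \<open>g \<ge> g(0) + D\<^sup>2 / (2\<gamma>) \<ge> g(0) + \<epsilon>\<^sup>2 / (2\<gamma>)\<close>, and \<open>\<theta> + t V\<^sub>\<tau>\<close> is feasible for the next search.
  The term \<open>x\<^sub>n\<^sup>2\<close> in \<open>\<gamma>\<close> only enlarges the constant.\<close>

lemma Lim_eventually_const:
  assumes "F \<noteq> bot" "eventually (\<lambda>y. g y = c) F"
  shows "(g \<longlongrightarrow> c) F" "Lim F g = c"
proof -
  show "(g \<longlongrightarrow> c) F" using assms(2) by (rule tendsto_eventually)
  then show "Lim F g = c" by (rule tendsto_Lim[OF assms(1)])
qed

lemma quotient_tendsto_of_quadratic_bounds:
  fixes g :: "real \<Rightarrow> real"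
  assumes "0 < r"
    and bounds: "\<And>t. 0 < t \<Longrightarrow> t < r \<Longrightarrow> g 0 + t * D - t\<^sup>2 * C \<le> g t \<and> g t \<le> g 0 + t * D"
  shows "((\<lambda>t. (g t - g 0) / t) \<longlongrightarrow> D) (at_right 0)"
proof (rule tendsto_sandwich)
  have near: "eventually (\<lambda>t. t \<in> {0<..<r}) (at_right 0)"
    using assms(1) by (intro eventually_at_right_real)
  show "eventually (\<lambda>t. D - t * C \<le> (g t - g 0) / t) (at_right 0)"
    using near by (rule eventually_mono) (use bounds in \<open>auto simp: le_divide_eq power2_eq_square algebra_simps\<close>)
  show "eventually (\<lambda>t. (g t - g 0) / t \<le> D) (at_right 0)"
    using near by (rule eventually_mono) (use bounds in \<open>auto simp: divide_le_eq algebra_simps\<close>)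
  show "((\<lambda>t. D - t * C) \<longlongrightarrow> D) (at_right 0)"
    by (auto intro!: tendsto_eq_intros)
qed simp

lemma real_step_induct:
  fixes a b \<eta> x :: real
  assumes "0 < \<eta>" "P a"
    and step: "\<And>t s. a \<le> t \<Longrightarrow> t \<le> b \<Longrightarrow> P t \<Longrightarrow> t \<le> s \<Longrightarrow> s \<le> t + \<eta> \<Longrightarrow> P s"
    and "a \<le> x" "x \<le> b"
  shows "P x"
proof -
  have "\<forall>x. a \<le> x \<and> x \<le> b \<and> x \<le> a + real n * \<eta> \<longrightarrow> P x" for n
  proof (induction n)
    case 0
    with \<open>P a\<close> show ?case by auto
  next
    case (Suc n)
    show ?case
    proof (intro allI impI)
      fix x assume x: "a \<le> x \<and> x \<le> b \<and> x \<le> a + real (Suc n) * \<eta>"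
      define t where "t = max a (x - \<eta>)"
      have "a \<le> t" "t \<le> x" "x \<le> t + \<eta>" "t \<le> a + real n * \<eta>"
        using x \<open>0 < \<eta>\<close> by (auto simp: t_def algebra_simps)
      with x Suc.IH show "P x" by (intro step[of t x]) auto
    qed
  qed
  moreover obtain n where "(x - a) / \<eta> \<le> real n" using real_arch_simple by blast
  then have "x \<le> a + real n * \<eta>" using \<open>0 < \<eta>\<close> by (simp add: divide_le_eq algebra_simps)
  ultimately show ?thesis using assms(4,5) by blast
qed

section \<open>Piecewise linear functions\<close>

lemma PLE:
  assumes "v \<in> PL"
  obtains S where "finite S" "S \<subseteq> {0..}"
    "\<And>a b z. 0 \<le> a \<Longrightarrow> a < b \<Longrightarrow> {a<..<b} \<inter> S = {} \<Longrightarrow> a \<le> z \<Longrightarrow> z \<le> b \<Longrightarrow>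
       v z = v a + (v b - v a) / (b - a) * (z - a)"
proof -
  obtain S where "finite S" "S \<subseteq> {0..}" and affine: "\<forall>a b. 0 \<le> a \<and> a < b \<and> {a<..<b} \<inter> S = {} \<longrightarrow>
      (\<forall>z\<in>{a..b}. v z = v a + (v b - v a) / (b - a) * (z - a))"
    using assms unfolding PL_def mem_Collect_eq by (elim conjE exE) (rule that)
  show thesis
  proof (rule that[OF \<open>finite S\<close> \<open>S \<subseteq> {0..}\<close>])
    fix a b z assume "0 \<le> a" "a < b" "{a<..<b} \<inter> S = {}" "a \<le> z" "z \<le> b"
    then show "v z = v a + (v b - v a) / (b - a) * (z - a)" using affine[rule_format, of a b z] by simp
  qed
qed

lemma PLI:
  assumes "continuous_on {0..} v" "finite S" "S \<subseteq> {0..}"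
    and "\<And>a b z. 0 \<le> a \<Longrightarrow> a < b \<Longrightarrow> {a<..<b} \<inter> S = {} \<Longrightarrow> a \<le> z \<Longrightarrow> z \<le> b \<Longrightarrow>
       v z = v a + (v b - v a) / (b - a) * (z - a)"
  shows "v \<in> PL"
  unfolding PL_def mem_Collect_eq
  by (intro conjI assms(1) exI[of _ S] assms(2,3) allI impI ballI assms(4)) auto

lemma PL_locally_affine:
  assumes "v \<in> PL" "0 \<le> x"
  obtains d where "0 < d"
    and "\<And>y. x \<le> y \<Longrightarrow> y \<le> x + d \<Longrightarrow> v y = v x + (v (x + d) - v x) / d * (y - x)"
    and "0 < x \<Longrightarrow> d \<le> x \<and> (\<forall>y. x - d \<le> y \<and> y \<le> x \<longrightarrow> v y = v x + (v x - v (x - d)) / d * (y - x))"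
proof -
  obtain S where "finite S" "S \<subseteq> {0..}" and affine:
    "\<And>a b z. 0 \<le> a \<Longrightarrow> a < b \<Longrightarrow> {a<..<b} \<inter> S = {} \<Longrightarrow> a \<le> z \<Longrightarrow> z \<le> b \<Longrightarrow>
       v z = v a + (v b - v a) / (b - a) * (z - a)"
    using PLE[OF assms(1)] by metis
  obtain e where "0 < e" and e: "\<And>s. s \<in> S \<Longrightarrow> s \<noteq> x \<Longrightarrow> e \<le> dist x s"
    using finite_set_avoid[OF \<open>finite S\<close>, of x] by blast
  define d where "d = (if 0 < x then min e x else e)"
  have "0 < d" using \<open>0 < e\<close> by (simp add: d_def)
  have "d \<le> e" by (simp add: d_def)
  have near: "s \<notin> S" if "s \<noteq> x" "\<bar>x - s\<bar> < d" for s
    using e[of s] that \<open>d \<le> e\<close> by (auto simp: dist_real_def)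
  have avoid: "{x - d<..<x} \<inter> S = {}" "{x<..<x + d} \<inter> S = {}"
    using near by fastforce+
  show ?thesis
  proof (rule that)
    show "0 < d" by fact
    fix y assume "x \<le> y" "y \<le> x + d"
    with affine[of x "x + d" y] \<open>0 \<le> x\<close> \<open>0 < d\<close> avoid(2)
    have "v y = v x + (v (x + d) - v x) / (x + d - x) * (y - x)" by simp
    then show "v y = v x + (v (x + d) - v x) / d * (y - x)" by simp
  next
    assume "0 < x"
    then have "d \<le> x" by (simp add: d_def)
    moreover have "v y = v x + (v x - v (x - d)) / d * (y - x)" if "x - d \<le> y" "y \<le> x" for y
    proof -
      from affine[of "x - d" x y] \<open>d \<le> x\<close> \<open>0 < d\<close> avoid(1) that
      have "v y = v (x - d) + (v x - v (x - d)) / (x - (x - d)) * (y - (x - d))" by simp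
      then show ?thesis using \<open>0 < d\<close> by (simp add: field_simps)
    qed
    ultimately show "d \<le> x \<and> (\<forall>y. x - d \<le> y \<and> y \<le> x \<longrightarrow> v y = v x + (v x - v (x - d)) / d * (y - x))"
      by blast
  qed
qed

lemma PL_right_quotient_tendsto:
  assumes "v \<in> PL" "0 \<le> x"
  shows "((\<lambda>y. (v y - v x) / (y - x)) \<longlongrightarrow> right_deriv v x) (at_right x)"
proof -
  obtain d where "0 < d" and affine: "\<And>y. x \<le> y \<Longrightarrow> y \<le> x + d \<Longrightarrow> v y = v x + (v (x + d) - v x) / d * (y - x)"
    by (rule PL_locally_affine[OF assms]) (rule that)
  have "eventually (\<lambda>y. y \<in> {x<..<x + d}) (at_right x)"
    using \<open>0 < d\<close> by (intro eventually_at_right_real) simp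
  then have "eventually (\<lambda>y. (v y - v x) / (y - x) = (v (x + d) - v x) / d) (at_right x)"
  proof (rule eventually_mono)
    fix y assume "y \<in> {x<..<x + d}"
    then show "(v y - v x) / (y - x) = (v (x + d) - v x) / d" using affine[of y] by simp
  qed
  from Lim_eventually_const[OF _ this] show ?thesis
    unfolding right_deriv_def by simp
qed

lemma PL_left_quotient_tendsto:
  assumes "v \<in> PL" "0 < x"
  shows "((\<lambda>y. (v y - v x) / (y - x)) \<longlongrightarrow> left_deriv v x) (at_left x)"
proof -
  obtain d where "0 < d" and affine: "\<And>y. x - d \<le> y \<Longrightarrow> y \<le> x \<Longrightarrow> v y = v x + (v x - v (x - d)) / d * (y - x)"
    by (rule PL_locally_affine[OF assms(1) less_imp_le[OF assms(2)]]) (use assms(2) that in blast)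
  have "eventually (\<lambda>y. y \<in> {x - d<..<x}) (at_left x)"
    using \<open>0 < d\<close> by (intro eventually_at_left_real) simp
  then have "eventually (\<lambda>y. (v y - v x) / (y - x) = (v x - v (x - d)) / d) (at_left x)"
  proof (rule eventually_mono)
    fix y assume "y \<in> {x - d<..<x}"
    then show "(v y - v x) / (y - x) = (v x - v (x - d)) / d" using affine[of y] by simp
  qed
  from Lim_eventually_const[OF _ this] show ?thesis
    unfolding left_deriv_def by simp
qed

lemma difference_quotient_add_scaled:
  fixes u w :: "real \<Rightarrow> real"
  shows "((u y + c * w y) - (u x + c * w x)) / (y - x) = (u y - u x) / (y - x) + c * ((w y - w x) / (y - x))"
proof -
  have "(u y + c * w y) - (u x + c * w x) = (u y - u x) + c * (w y - w x)" by (simp add: algebra_simps)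
  then show ?thesis by (simp only: add_divide_distrib times_divide_eq_right)
qed

lemma PL_add_scaled:
  assumes "u \<in> PL" "w \<in> PL"
  shows "(\<lambda>x. u x + c * w x) \<in> PL"
proof -
  obtain S where S: "finite S" "S \<subseteq> {0..}" and affine_u:
    "\<And>a b z. 0 \<le> a \<Longrightarrow> a < b \<Longrightarrow> {a<..<b} \<inter> S = {} \<Longrightarrow> a \<le> z \<Longrightarrow> z \<le> b \<Longrightarrow>
       u z = u a + (u b - u a) / (b - a) * (z - a)"
    using PLE[OF assms(1)] by metis
  obtain T where T: "finite T" "T \<subseteq> {0..}" and affine_w:
    "\<And>a b z. 0 \<le> a \<Longrightarrow> a < b \<Longrightarrow> {a<..<b} \<inter> T = {} \<Longrightarrow> a \<le> z \<Longrightarrow> z \<le> b \<Longrightarrow>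
       w z = w a + (w b - w a) / (b - a) * (z - a)"
    using PLE[OF assms(2)] by metis
  show ?thesis
  proof (rule PLI[where S = "S \<union> T"])
    show "continuous_on {0..} (\<lambda>x. u x + c * w x)"
      using assms by (intro continuous_intros) (simp_all add: PL_def)
    fix a b z assume ab: "0 \<le> a" "a < b" "{a<..<b} \<inter> (S \<union> T) = {}" "a \<le> z" "z \<le> b"
    then have "u z = u a + (u b - u a) / (b - a) * (z - a)" "w z = w a + (w b - w a) / (b - a) * (z - a)"
      using affine_u[of a b z] affine_w[of a b z] by blast+
    then have "u z + c * w z = u a + c * w a + ((u b - u a) / (b - a) + c * ((w b - w a) / (b - a))) * (z - a)"
      by (simp add: algebra_simps)
    then show "u z + c * w z = u a + c * w a + (u b + c * w b - (u a + c * w a)) / (b - a) * (z - a)"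
      by (simp only: difference_quotient_add_scaled)
  qed (use S T in auto)
qed

lemma hinge_PL:
  assumes "0 \<le> \<tau>"
  shows "hinge \<tau> \<in> PL"
proof (rule PLI[where S = "{\<tau>}"])
  show "continuous_on {0..} (hinge \<tau>)" unfolding hinge_def by (intro continuous_intros)
  fix a b z assume ab: "0 \<le> a" "a < b" "{a<..<b} \<inter> {\<tau>} = {}" "a \<le> z" "z \<le> b"
  then consider "\<tau> \<le> a" | "b \<le> \<tau>" by fastforce
  then show "hinge \<tau> z = hinge \<tau> a + (hinge \<tau> b - hinge \<tau> a) / (b - a) * (z - a)"
    by cases (use ab in \<open>simp_all add: hinge_def\<close>)
qed (use assms in auto)

lemma one_sided_derivs_eq_deriv:
  assumes "(v has_real_derivative d) (at x)"
  shows "left_deriv v x = d" "right_deriv v x = d"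
proof -
  have "((\<lambda>y. (v y - v x) / (y - x)) \<longlongrightarrow> d) (at x)"
    using assms by (simp add: has_field_derivative_iff)
  then have "((\<lambda>y. (v y - v x) / (y - x)) \<longlongrightarrow> d) (at_left x)"
    "((\<lambda>y. (v y - v x) / (y - x)) \<longlongrightarrow> d) (at_right x)"
    by (auto intro: tendsto_mono[OF at_le[OF subset_UNIV]])
  then show "left_deriv v x = d" "right_deriv v x = d"
    unfolding left_deriv_def right_deriv_def by (auto intro!: tendsto_Lim)
qed

lemma hinge_has_real_derivative:
  assumes "x \<noteq> \<tau>"
  shows "(hinge \<tau> has_real_derivative (if \<tau> < x then 1 else 0)) (at x)"
proof (cases "\<tau> < x")
  case True
  have "((\<lambda>y. y - \<tau>) has_real_derivative 1) (at x)" by (auto intro!: derivative_eq_intros)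
  then have "(hinge \<tau> has_real_derivative 1) (at x)"
    by (rule has_field_derivative_transform_within_open[where S = "{\<tau><..}"])
      (use True in \<open>auto simp: hinge_def\<close>)
  with True show ?thesis by simp
next
  case False
  with assms have "x < \<tau>" by simp
  have "((\<lambda>y. 0) has_real_derivative 0) (at x)" by simp
  then have "(hinge \<tau> has_real_derivative 0) (at x)"
    by (rule has_field_derivative_transform_within_open[where S = "{..<\<tau>}"])
      (use \<open>x < \<tau>\<close> in \<open>auto simp: hinge_def\<close>)
  with False show ?thesis by simp
qed

lemma breakpoints_hinge: "breakpoints (hinge \<tau>) \<subseteq> {\<tau>}"
  using one_sided_derivs_eq_deriv[OF hinge_has_real_derivative] by (force simp: breakpoints_def)

lemma breakpoints_add_scaled:
  assumes "u \<in> PL" "w \<in> PL"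
  shows "breakpoints (\<lambda>x. u x + c * w x) \<subseteq> breakpoints u \<union> breakpoints w"
proof
  fix x assume x: "x \<in> breakpoints (\<lambda>x. u x + c * w x)"
  then have "0 < x" by (simp add: breakpoints_def)
  have "left_deriv (\<lambda>x. u x + c * w x) x = left_deriv u x + c * left_deriv w x"
    unfolding left_deriv_def difference_quotient_add_scaled
    using \<open>0 < x\<close> assms by (intro tendsto_Lim tendsto_intros PL_left_quotient_tendsto[unfolded left_deriv_def]) auto
  moreover have "right_deriv (\<lambda>x. u x + c * w x) x = right_deriv u x + c * right_deriv w x"
    unfolding right_deriv_def difference_quotient_add_scaled
    using \<open>0 < x\<close> assms by (intro tendsto_Lim tendsto_intros PL_right_quotient_tendsto[unfolded right_deriv_def]) auto
  ultimately show "x \<in> breakpoints u \<union> breakpoints w"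
    using x \<open>0 < x\<close> by (auto simp: breakpoints_def)
qed

lemma hinge_Theta: "hinge \<tau> \<in> Theta"
proof -
  have "convex_on {0..} (hinge \<tau>)"
  proof (rule convex_onI)
    fix t x y :: real assume t: "0 < t" "t < 1"
    have "(1 - t) * x + t * y - \<tau> = (1 - t) * (x - \<tau>) + t * (y - \<tau>)" by (simp add: algebra_simps)
    moreover have "(1 - t) * (x - \<tau>) \<le> (1 - t) * hinge \<tau> x" "t * (y - \<tau>) \<le> t * hinge \<tau> y"
      using t by (intro mult_left_mono; simp add: hinge_def)+
    moreover have "0 \<le> (1 - t) * hinge \<tau> x + t * hinge \<tau> y"
      using t by (simp add: hinge_def)
    ultimately show "hinge \<tau> ((1 - t) *\<^sub>R x + t *\<^sub>R y) \<le> (1 - t) * hinge \<tau> x + t * hinge \<tau> y"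
      by (simp add: hinge_def)
  qed (simp add: convex_real_interval)
  moreover have "mono_on {0..} (hinge \<tau>)" by (intro mono_onI) (simp add: hinge_def)
  ultimately show ?thesis by (simp add: Theta_def)
qed

lemma Theta_add_scaled:
  assumes "u \<in> Theta" "w \<in> Theta" "0 \<le> c"
  shows "(\<lambda>x. u x + c * w x) \<in> Theta"
  using assms unfolding Theta_def
  by (auto intro!: convex_on_add convex_on_cmul mono_onI add_mono mult_left_mono dest: mono_onD)

lemma add_scaled_hinge_mem:
  assumes "\<theta> \<in> Theta \<inter> PL" "0 \<le> \<tau>" "0 \<le> t"
  shows "(\<lambda>x. \<theta> x + t * hinge \<tau> x) \<in> Theta \<inter> PL_on (breakpoints \<theta> \<union> {\<tau>})"
  using assms Theta_add_scaled[OF _ hinge_Theta] PL_add_scaled[OF _ hinge_PL]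
    breakpoints_add_scaled[OF _ hinge_PL] breakpoints_hinge
  by (fastforce simp: PL_on_def)

lemma convex_slopes_le:
  fixes \<phi> :: "real \<Rightarrow> real"
  assumes "convex_on {0..} \<phi>" "0 \<le> a" "a < b" "b < c"
  shows "(\<phi> b - \<phi> a) / (b - a) \<le> (\<phi> c - \<phi> a) / (c - a)"
    and "(\<phi> c - \<phi> a) / (c - a) \<le> (\<phi> c - \<phi> b) / (c - b)"
proof -
  have flip: "(\<phi> p - \<phi> q) / (p - q) = (\<phi> q - \<phi> p) / (q - p)" for p q
    by (metis minus_diff_eq minus_divide_divide)
  from convex_on_slope_le[OF assms(1) _ _ assms(3,4)] assms(2,3,4)
  show "(\<phi> b - \<phi> a) / (b - a) \<le> (\<phi> c - \<phi> a) / (c - a)"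
    and "(\<phi> c - \<phi> a) / (c - a) \<le> (\<phi> c - \<phi> b) / (c - b)"
    by (simp_all add: flip[of a] flip[of b c])
qed

lemma right_deriv_le_slope:
  assumes "convex_on {0..} \<phi>" "\<phi> \<in> PL" "0 \<le> x" "x < z"
  shows "right_deriv \<phi> x \<le> (\<phi> z - \<phi> x) / (z - x)"
proof (rule tendsto_upperbound[OF PL_right_quotient_tendsto[OF assms(2,3)]])
  have "eventually (\<lambda>y. y \<in> {x<..<z}) (at_right x)"
    using assms(4) by (intro eventually_at_right_real)
  then show "eventually (\<lambda>y. (\<phi> y - \<phi> x) / (y - x) \<le> (\<phi> z - \<phi> x) / (z - x)) (at_right x)"
    by (rule eventually_mono) (use convex_slopes_le(1)[OF assms(1,3)] in auto)
qed simp

lemma slope_le_right_deriv: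
  assumes "convex_on {0..} \<phi>" "\<phi> \<in> PL" "0 \<le> w" "w < x"
  shows "(\<phi> x - \<phi> w) / (x - w) \<le> right_deriv \<phi> x"
proof (rule tendsto_lowerbound[OF PL_right_quotient_tendsto[OF assms(2)]])
  have "eventually (\<lambda>y. y \<in> {x<..<x + 1}) (at_right x)"
    by (intro eventually_at_right_real) simp
  then show "eventually (\<lambda>y. (\<phi> x - \<phi> w) / (x - w) \<le> (\<phi> y - \<phi> x) / (y - x)) (at_right x)"
    by (rule eventually_mono) (use convex_slopes_le[OF assms(1,3,4)] in force)
qed (use assms in auto)

text \<open>Without this bound the supremum of the right derivatives would be an unspecified junk value.\<close>

lemma PL_convex_right_deriv_bdd_above:
  assumes "convex_on {0..} \<phi>" "\<phi> \<in> PL"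
  shows "bdd_above (right_deriv \<phi> ` {0..})"
proof -
  obtain S where "finite S" "S \<subseteq> {0..}" and affine:
    "\<And>a b z. 0 \<le> a \<Longrightarrow> a < b \<Longrightarrow> {a<..<b} \<inter> S = {} \<Longrightarrow> a \<le> z \<Longrightarrow> z \<le> b \<Longrightarrow>
       \<phi> z = \<phi> a + (\<phi> b - \<phi> a) / (b - a) * (z - a)"
    using PLE[OF assms(2)] by metis
  define m where "m = Max (insert 0 S)"
  have "0 \<le> m" and beyond: "\<And>s. s \<in> S \<Longrightarrow> s \<le> m" using \<open>finite S\<close> by (auto simp: m_def)
  have tail: "\<phi> (z + 1) - \<phi> z = \<phi> (m + 1) - \<phi> m" if "m \<le> z" for z
  proof -
    define Q where "Q = (\<phi> (z + 1) - \<phi> m) / (z + 1 - m)"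
    have "{m<..<z + 1} \<inter> S = {}" using beyond by force
    then have line: "\<phi> y = \<phi> m + Q * (y - m)" if "m \<le> y" "y \<le> z + 1" for y
      using affine[of m "z + 1" y] \<open>0 \<le> m\<close> \<open>m \<le> z\<close> that unfolding Q_def by simp
    show ?thesis
      using line[of z] line[of "z + 1"] line[of "m + 1"] \<open>m \<le> z\<close> by (simp add: algebra_simps)
  qed
  show ?thesis
  proof (rule bdd_aboveI2)
    fix x :: real assume "x \<in> {0..}"
    define z where "z = max x m + 1"
    have "x < z" "m \<le> z" "0 \<le> x" using \<open>x \<in> {0..}\<close> by (auto simp: z_def)
    have "right_deriv \<phi> x \<le> (\<phi> z - \<phi> x) / (z - x)"
      using right_deriv_le_slope[OF assms \<open>0 \<le> x\<close> \<open>x < z\<close>] .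
    also have "\<dots> \<le> (\<phi> (z + 1) - \<phi> x) / (z + 1 - x)"
      using convex_slopes_le(1)[OF assms(1) \<open>0 \<le> x\<close> \<open>x < z\<close>, of "z + 1"] by simp
    also have "\<dots> \<le> (\<phi> (z + 1) - \<phi> z) / (z + 1 - z)"
      using convex_slopes_le(2)[OF assms(1) \<open>0 \<le> x\<close> \<open>x < z\<close>, of "z + 1"] by simp
    also have "\<dots> = \<phi> (m + 1) - \<phi> m"
      using tail[OF \<open>m \<le> z\<close>] by simp
    finally show "right_deriv \<phi> x \<le> \<phi> (m + 1) - \<phi> m" .
  qed
qed

lemma PL_convex_le_affine:
  assumes "convex_on {0..} \<phi>" "\<phi> \<in> PL" "0 \<le> x"
  shows "\<phi> x \<le> \<phi> 0 + (SUP y\<in>{0..}. right_deriv \<phi> y) * x"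
proof (cases "x = 0")
  case False
  with assms(3) have "0 < x" by simp
  have "(\<phi> x - \<phi> 0) / x \<le> right_deriv \<phi> x"
    using slope_le_right_deriv[OF assms(1,2) order_refl \<open>0 < x\<close>] by simp
  also have "\<dots> \<le> (SUP y\<in>{0..}. right_deriv \<phi> y)"
    using PL_convex_right_deriv_bdd_above[OF assms(1,2)] assms(3) by (intro cSUP_upper) auto
  finally show ?thesis using \<open>0 < x\<close> by (simp add: divide_le_eq algebra_simps)
qed simp

section \<open>Exponential integrals along a ray\<close>

lemma exp_add_ge_linear:
  fixes a b :: real
  shows "exp a + b * exp a \<le> exp (a + b)"
  using mult_left_mono[OF exp_ge_add_one_self[of b], of "exp a"] by (simp add: exp_add algebra_simps)

lemma exp_add_le_quadratic:
  fixes a b :: real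
  assumes "0 \<le> b"
  shows "exp (a + b) \<le> exp a + b * exp a + b\<^sup>2 / 2 * exp (a + b)"
proof (cases "b = 0")
  case False
  obtain u where "\<bar>u\<bar> < \<bar>b\<bar>" and taylor: "exp b = (\<Sum>m<2. b ^ m / fact m) + exp u / fact 2 * b ^ 2"
    using Maclaurin_exp_lt[OF False, of 2] by auto
  have "exp u \<le> exp b" using \<open>\<bar>u\<bar> < \<bar>b\<bar>\<close> assms by simp
  then have "exp u / 2 * b\<^sup>2 \<le> exp b / 2 * b\<^sup>2" by (intro mult_right_mono) auto
  moreover have "exp b = 1 + b + exp u / 2 * b\<^sup>2" using taylor by (simp add: numeral_2_eq_2)
  ultimately have "exp b \<le> 1 + b + b\<^sup>2 / 2 * exp b" by (simp only: mult.commute)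
  from mult_left_mono[OF this, of "exp a"] show ?thesis by (simp add: exp_add algebra_simps)
qed simp

lemma exp_add_diff_le:
  fixes a b :: real
  shows "exp (a + b) - exp a \<le> b * exp (a + b)"
  using exp_add_ge_linear[of "a + b" "- b"] by (simp add: algebra_simps)

lemma integrable_exp_moments:
  fixes M :: "real measure"
  assumes "sets M = sets borel"
    and "integrable M (\<lambda>x. exp (l * x))" "integrable M (\<lambda>x. x\<^sup>2 * exp (l * x))"
  shows "integrable M (\<lambda>x. exp (c + l * x))"
    and "integrable M (\<lambda>x. x * exp (c + l * x))"
    and "integrable M (\<lambda>x. x\<^sup>2 * exp (c + l * x))"
proof -
  have shift: "exp (c + l * x) = exp c * exp (l * x)" for x by (simp add: exp_add)
  have "integrable M (\<lambda>x. x * exp (l * x))"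
  proof (rule Bochner_Integration.integrable_bound)
    show "integrable M (\<lambda>x. exp (l * x) + x\<^sup>2 * exp (l * x))" using assms(2,3) by simp
    show "(\<lambda>x. x * exp (l * x)) \<in> borel_measurable M"
      by (subst measurable_cong_sets[OF assms(1) refl]) simp
    have "\<bar>x\<bar> * exp (l * x) \<le> (1 + x\<^sup>2) * exp (l * x)" for x :: real
    proof (rule mult_right_mono)
      have "\<bar>x\<bar> \<le> 1 + \<bar>x\<bar> * \<bar>x\<bar>"
      proof (cases "\<bar>x\<bar> \<le> 1")
        case False
        then have "\<bar>x\<bar> * 1 \<le> \<bar>x\<bar> * \<bar>x\<bar>" by (intro mult_left_mono) auto
        then show ?thesis by simp
      qed (simp add: add_increasing2)
      then show "\<bar>x\<bar> \<le> 1 + x\<^sup>2" by (simp add: power2_eq_square)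
    qed simp
    then show "AE x in M. norm (x * exp (l * x)) \<le> norm (exp (l * x) + x\<^sup>2 * exp (l * x))"
      by (intro AE_I2) (simp add: abs_mult algebra_simps)
  qed
  with assms(2,3) show "integrable M (\<lambda>x. exp (c + l * x))"
    and "integrable M (\<lambda>x. x * exp (c + l * x))"
    and "integrable M (\<lambda>x. x\<^sup>2 * exp (c + l * x))"
    by (simp_all add: shift mult.left_commute[of _ "exp c"])
qed

lemma integrable_exp_ray:
  fixes M :: "real measure" and a h E :: "real \<Rightarrow> real"
  assumes [measurable]: "a \<in> borel_measurable M" "h \<in> borel_measurable M"
    and "AE x in M. 0 \<le> h x" "t \<le> s"
    and "integrable M E" "AE x in M. exp (a x + s * h x) \<le> E x"
  shows "integrable M (\<lambda>x. exp (a x + t * h x))"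
proof (rule Bochner_Integration.integrable_bound[OF assms(5)])
  show "AE x in M. norm (exp (a x + t * h x)) \<le> norm (E x)"
    using assms(3,6)
  proof eventually_elim
    case (elim x)
    have "exp (a x + t * h x) \<le> exp (a x + s * h x)"
      using elim(1) \<open>t \<le> s\<close> by (simp add: mult_right_mono)
    with elim(2) have "exp (a x + t * h x) \<le> E x" by linarith
    then show ?case by (simp add: abs_of_nonneg[OF order_trans[OF exp_ge_zero]])
  qed
qed measurable

lemma integrable_mult_exp_ray:
  fixes M :: "real measure" and a h E :: "real \<Rightarrow> real"
  assumes [measurable]: "a \<in> borel_measurable M" "h \<in> borel_measurable M"
    and h: "AE x in M. 0 \<le> h x \<and> h x \<le> x" and "0 \<le> t"
    and E: "integrable M (\<lambda>x. x * E x)" and env: "AE x in M. exp (a x + t * h x) \<le> E x"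
  shows "integrable M (\<lambda>x. h x * exp (a x))"
proof (rule Bochner_Integration.integrable_bound[OF E])
  show "AE x in M. norm (h x * exp (a x)) \<le> norm (x * E x)"
    using h env
  proof eventually_elim
    case (elim x)
    have "exp (a x) \<le> exp (a x + t * h x)" using elim(1) \<open>0 \<le> t\<close> by simp
    with elim(2) have "exp (a x) \<le> E x" by linarith
    with elim(1) have "h x * exp (a x) \<le> x * E x" by (intro mult_mono) auto
    with elim show ?case by simp
  qed
qed measurable

lemma exp_ray_integral_bounds:
  fixes M :: "real measure" and a h E :: "real \<Rightarrow> real"
  assumes [measurable]: "a \<in> borel_measurable M" "h \<in> borel_measurable M"
    and h: "AE x in M. 0 \<le> h x \<and> h x \<le> x" and "0 \<le> t"
    and E: "integrable M E" "integrable M (\<lambda>x. x * E x)" "integrable M (\<lambda>x. x\<^sup>2 * E x)"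
    and env: "AE x in M. exp (a x + t * h x) \<le> E x"
  shows "(\<integral>x. exp (a x) \<partial>M) + t * (\<integral>x. h x * exp (a x) \<partial>M) \<le> (\<integral>x. exp (a x + t * h x) \<partial>M)"
    and "(\<integral>x. exp (a x + t * h x) \<partial>M)
           \<le> (\<integral>x. exp (a x) \<partial>M) + t * (\<integral>x. h x * exp (a x) \<partial>M) + t\<^sup>2 / 2 * (\<integral>x. x\<^sup>2 * E x \<partial>M)"
proof -
  have h_nonneg: "AE x in M. 0 \<le> h x" using h by auto
  have "integrable M (\<lambda>x. exp (a x + 0 * h x))"
    by (rule integrable_exp_ray[OF assms(1,2) h_nonneg \<open>0 \<le> t\<close> E(1) env])
  then have int_a: "integrable M (\<lambda>x. exp (a x))" by simp
  have int_ray_t: "integrable M (\<lambda>x. exp (a x + t * h x))"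
    by (rule integrable_exp_ray[OF assms(1,2) h_nonneg order_refl E(1) env])
  have int_ha: "integrable M (\<lambda>x. h x * exp (a x))"
    by (rule integrable_mult_exp_ray[OF assms(1,2) h \<open>0 \<le> t\<close> E(2) env])
  have "(\<integral>x. exp (a x) + t * (h x * exp (a x)) \<partial>M) \<le> (\<integral>x. exp (a x + t * h x) \<partial>M)"
    using int_a int_ha int_ray_t exp_add_ge_linear[of "a _" "t * h _"]
    by (intro integral_mono_AE AE_I2) (auto simp: mult.assoc)
  with int_a int_ha show "(\<integral>x. exp (a x) \<partial>M) + t * (\<integral>x. h x * exp (a x) \<partial>M) \<le> (\<integral>x. exp (a x + t * h x) \<partial>M)"
    by simp
  have "(\<integral>x. exp (a x + t * h x) \<partial>M) \<le> (\<integral>x. exp (a x) + t * (h x * exp (a x)) + t\<^sup>2 / 2 * (x\<^sup>2 * E x) \<partial>M)"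
  proof (rule integral_mono_AE)
    show "AE x in M. exp (a x + t * h x) \<le> exp (a x) + t * (h x * exp (a x)) + t\<^sup>2 / 2 * (x\<^sup>2 * E x)"
      using h env
    proof eventually_elim
      case (elim x)
      have "(t * h x)\<^sup>2 \<le> (t * x)\<^sup>2"
        using elim(1) \<open>0 \<le> t\<close> by (intro power_mono mult_left_mono) auto
      then have "(t * h x)\<^sup>2 / 2 * exp (a x + t * h x) \<le> t\<^sup>2 / 2 * (x\<^sup>2 * E x)"
        using elim(2) mult_mono[of "(t * h x)\<^sup>2" "(t * x)\<^sup>2" "exp (a x + t * h x)" "E x"]
        by (simp add: power_mult_distrib algebra_simps)
      then show ?case
        using exp_add_le_quadratic[of "t * h x" "a x"] elim(1) \<open>0 \<le> t\<close> by (simp add: mult.assoc)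
    qed
  qed (use int_a int_ha int_ray_t E(3) in auto)
  with int_a int_ha E(3)
  show "(\<integral>x. exp (a x + t * h x) \<partial>M)
      \<le> (\<integral>x. exp (a x) \<partial>M) + t * (\<integral>x. h x * exp (a x) \<partial>M) + t\<^sup>2 / 2 * (\<integral>x. x\<^sup>2 * E x \<partial>M)"
    by simp
qed

lemma exp_ray_integral_step:
  fixes M :: "real measure" and a h E :: "real \<Rightarrow> real"
  assumes [measurable]: "a \<in> borel_measurable M" "h \<in> borel_measurable M"
    and h: "AE x in M. 0 \<le> h x \<and> h x \<le> x" and "t \<le> s"
    and E: "integrable M E" "integrable M (\<lambda>x. x * E x)"
    and env: "AE x in M. exp (a x + s * h x) \<le> E x"
  shows "(\<integral>x. exp (a x + s * h x) \<partial>M) \<le> (\<integral>x. exp (a x + t * h x) \<partial>M) + (s - t) * (\<integral>x. x * E x \<partial>M)"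
proof -
  have h_nonneg: "AE x in M. 0 \<le> h x" using h by auto
  note int_ray = integrable_exp_ray[OF assms(1,2) h_nonneg _ E(1) env]
  have "(\<integral>x. exp (a x + s * h x) \<partial>M) \<le> (\<integral>x. exp (a x + t * h x) + (s - t) * (x * E x) \<partial>M)"
  proof (rule integral_mono_AE)
    show "AE x in M. exp (a x + s * h x) \<le> exp (a x + t * h x) + (s - t) * (x * E x)"
      using h env
    proof eventually_elim
      case (elim x)
      have eq: "a x + t * h x + (s - t) * h x = a x + s * h x" by (simp add: algebra_simps)
      have "exp (a x + s * h x) - exp (a x + t * h x) \<le> (s - t) * (h x * exp (a x + s * h x))"
        using exp_add_diff_le[of "a x + t * h x" "(s - t) * h x"] unfolding eq mult.assoc .
      moreover have "(s - t) * (h x * exp (a x + s * h x)) \<le> (s - t) * (x * E x)"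
        using elim \<open>t \<le> s\<close> by (intro mult_left_mono mult_mono) auto
      ultimately show ?case by linarith
    qed
  qed (use int_ray \<open>t \<le> s\<close> E(2) in auto)
  with int_ray[of t] E(2) \<open>t \<le> s\<close> show ?thesis by simp
qed

lemma sets_dens_measure [simp]: "sets (dens_measure f) = sets borel"
  by (simp add: dens_measure_def)

lemma measurable_dens_measure [simp, measurable_cong]: "measurable (dens_measure f) N = measurable borel N"
  by (rule measurable_cong_sets) auto

lemma AE_dens_measure_nonneg:
  assumes "continuous_on {0..} f"
  shows "AE x in dens_measure f. 0 \<le> x"
proof -
  have "(\<lambda>x. indicator {0..} x *\<^sub>R f x) \<in> borel_measurable borel"
    using assms by (intro borel_measurable_continuous_on_indicator) auto
  then have "(\<lambda>x. ennreal (indicator {0..} x * f x)) \<in> borel_measurable borel" by simp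
  then show ?thesis
    unfolding dens_measure_def by (subst AE_density) (auto simp: indicator_def)
qed

lemma Lobj_cong:
  assumes "continuous_on {0..} f" "\<forall>x\<in>set xs. 0 \<le> x" "\<And>x. 0 \<le> x \<Longrightarrow> \<phi> x = \<psi> x"
  shows "Lobj f xs \<phi> = Lobj f xs \<psi>"
proof -
  have "map \<phi> xs = map \<psi> xs" using assms(2,3) by simp
  moreover have "(\<integral>\<^sup>+ x. ennreal (exp (\<phi> x)) \<partial>dens_measure f) = (\<integral>\<^sup>+ x. ennreal (exp (\<psi> x)) \<partial>dens_measure f)"
    using AE_dens_measure_nonneg[OF assms(1)] by (intro nn_integral_cong_AE) (auto elim!: eventually_mono simp: assms(3))
  ultimately show ?thesis unfolding Lobj_def by (simp only:)
qed

lemma Lobj_eq_ereal: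
  assumes "integrable (dens_measure f) (\<lambda>x. exp (u x))"
  shows "Lobj f xs u = ereal (sum_list (map u xs) / real (length xs) - (\<integral>x. exp (u x) \<partial>dens_measure f) + 1)"
proof -
  have "(\<integral>\<^sup>+ x. ennreal (exp (u x)) \<partial>dens_measure f) = ennreal (\<integral>x. exp (u x) \<partial>dens_measure f)"
    using assms by (intro nn_integral_eq_integral) auto
  moreover have "0 \<le> (\<integral>x. exp (u x) \<partial>dens_measure f)" by simp
  ultimately show ?thesis by (simp add: Lobj_def)
qed

section \<open>One step of the line search\<close>

locale hinge_line_search =
  fixes f :: "real \<Rightarrow> real" and \<beta> :: real and xs :: "real list"
    and sR mR \<tau> :: real and \<theta> :: "real \<Rightarrow> real"
  assumes f_cont: "continuous_on {0..} f"
    and exp_moments: "\<And>l. l < \<beta> \<Longrightarrow>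
      integrable (dens_measure f) (\<lambda>x. exp (l * x)) \<and> integrable (dens_measure f) (\<lambda>x. x\<^sup>2 * exp (l * x))"
    and data_nonneg: "\<forall>x\<in>set xs. 0 \<le> x"
    and \<theta>_mem: "\<theta> \<in> Theta \<inter> PL"
    and \<tau>_nonneg: "0 \<le> \<tau>"
    and mR_less: "mR < \<beta>"
    and superlevel_bound: "\<And>\<phi>. \<phi> \<in> Theta \<Longrightarrow> Lobj f xs \<theta> \<le> Lobj f xs \<phi> \<Longrightarrow>
      \<bar>\<phi> 0\<bar> \<le> sR \<and> (SUP x\<in>{0..}. right_deriv \<phi> x) \<le> mR"
begin

abbreviation M :: "real measure" where "M \<equiv> dens_measure f"

definition ray :: "real \<Rightarrow> real \<Rightarrow> real" where "ray t = (\<lambda>x. \<theta> x + t * hinge \<tau> x)"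

definition improves :: "real \<Rightarrow> bool" where "improves t \<longleftrightarrow> Lobj f xs \<theta> \<le> Lobj f xs (ray t)"

text \<open>\<open>\<theta>\<close> is only continuous on \<open>[0,\<infinity>)\<close>; extending it by \<open>\<theta> 0\<close> to the left makes it Borel
  measurable on the whole line without changing any integral against \<open>M\<close>.\<close>
definition \<theta>e :: "real \<Rightarrow> real" where "\<theta>e x = \<theta> (max x 0)"

definition \<delta> :: real where "\<delta> = (\<beta> - mR) / 2"

definition env :: "real \<Rightarrow> real \<Rightarrow> real" where "env d x = exp (sR + (mR + d) * x)"

definition mean :: "(real \<Rightarrow> real) \<Rightarrow> real" where "mean g = sum_list (map g xs) / real (length xs)"

definition L_ray :: "real \<Rightarrow> real" where
  "L_ray t = mean \<theta> + t * mean (hinge \<tau>) - (\<integral>x. exp (\<theta>e x + t * hinge \<tau> x) \<partial>M) + 1"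

definition dir_deriv :: real where "dir_deriv = mean (hinge \<tau>) - (\<integral>x. hinge \<tau> x * exp (\<theta>e x) \<partial>M)"

lemma \<delta>_pos: "0 < \<delta>"
  using mR_less by (simp add: \<delta>_def)

lemma \<delta>_less: "\<delta> < \<beta> - mR"
  using mR_less by (simp add: \<delta>_def)

lemma env_integrable:
  assumes "d < \<beta> - mR"
  shows "integrable M (env d)" "integrable M (\<lambda>x. x * env d x)" "integrable M (\<lambda>x. x\<^sup>2 * env d x)"
  using integrable_exp_moments[OF _ conjunct1[OF exp_moments] conjunct2[OF exp_moments], of "mR + d" sR] assms
  by (simp_all add: env_def[abs_def])

lemma \<theta>e_measurable [measurable]: "\<theta>e \<in> borel_measurable borel"
proof -
  have "continuous_on {0..} \<theta>" using \<theta>_mem by (simp add: PL_def)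
  then have "continuous_on UNIV \<theta>e"
    unfolding \<theta>e_def by (rule continuous_on_compose2) (auto intro!: continuous_intros)
  then show ?thesis by (rule borel_measurable_continuous_onI)
qed

lemma hinge_measurable [measurable]: "hinge \<tau> \<in> borel_measurable borel"
  unfolding hinge_def by measurable

lemma hinge_bounds_AE: "AE x in M. 0 \<le> hinge \<tau> x \<and> hinge \<tau> x \<le> x"
  using AE_dens_measure_nonneg[OF f_cont] by eventually_elim (use \<tau>_nonneg in \<open>simp add: hinge_def\<close>)

lemma Lobj_ray:
  assumes "integrable M (\<lambda>x. exp (\<theta>e x + t * hinge \<tau> x))"
  shows "Lobj f xs (ray t) = ereal (L_ray t)"
proof -
  have "Lobj f xs (ray t) = Lobj f xs (\<lambda>x. \<theta>e x + t * hinge \<tau> x)"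
    by (rule Lobj_cong[OF f_cont data_nonneg]) (simp add: ray_def \<theta>e_def)
  moreover have "map \<theta>e xs = map \<theta> xs" using data_nonneg by (simp add: \<theta>e_def)
  ultimately show ?thesis
    using Lobj_eq_ereal[OF assms, of xs]
    by (simp add: L_ray_def mean_def sum_list_addf sum_list_const_mult add_divide_distrib)
qed

lemma ray_0: "ray 0 = \<theta>"
  by (simp add: ray_def)

lemma improves_0: "improves 0"
  by (simp add: improves_def ray_0)

lemma ray_mem: "0 \<le> t \<Longrightarrow> ray t \<in> Theta \<inter> PL_on (breakpoints \<theta> \<union> {\<tau>})"
  unfolding ray_def using \<theta>_mem \<tau>_nonneg by (rule add_scaled_hinge_mem)

lemma ray_le_envelope:
  assumes "0 \<le> t" "improves t" "0 \<le> x"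
  shows "ray t x \<le> sR + mR * x"
proof -
  have mem: "ray t \<in> Theta" "ray t \<in> PL" using ray_mem[OF assms(1)] by (auto simp: PL_on_def)
  then have bound: "\<bar>ray t 0\<bar> \<le> sR" "(SUP y\<in>{0..}. right_deriv (ray t) y) \<le> mR"
    using superlevel_bound assms(2) by (auto simp: improves_def)
  have "ray t x \<le> ray t 0 + (SUP y\<in>{0..}. right_deriv (ray t) y) * x"
    using mem assms(3) by (intro PL_convex_le_affine) (auto simp: Theta_def)
  also have "\<dots> \<le> sR + mR * x"
    using bound assms(3) by (intro add_mono mult_right_mono) auto
  finally show ?thesis .
qed

lemma exp_ray_le_env:
  assumes "0 \<le> t" "improves t" "0 \<le> d" "t \<le> s" "s \<le> t + d"
  shows "AE x in M. exp (\<theta>e x + s * hinge \<tau> x) \<le> env d x"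
  using hinge_bounds_AE
proof eventually_elim
  case (elim x)
  then have "\<theta>e x + t * hinge \<tau> x \<le> sR + mR * x"
    using ray_le_envelope[OF assms(1,2)] by (simp add: ray_def \<theta>e_def)
  moreover have "(s - t) * hinge \<tau> x \<le> d * x"
    using elim assms by (intro mult_mono) auto
  ultimately show ?case by (simp add: env_def algebra_simps)
qed

lemma mean_hinge_nonneg: "0 \<le> mean (hinge \<tau>)"
  unfolding mean_def by (intro divide_nonneg_nonneg sum_list_nonneg) (auto simp: hinge_def)

lemma ray_expansion:
  assumes "0 \<le> t" "d < \<beta> - mR" and env: "AE x in M. exp (\<theta>e x + t * hinge \<tau> x) \<le> env d x"
  shows "Lobj f xs (ray t) = ereal (L_ray t)"
    and "L_ray 0 + t * dir_deriv - t\<^sup>2 / 2 * (\<integral>x. x\<^sup>2 * env d x \<partial>M) \<le> L_ray t"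
    and "L_ray t \<le> L_ray 0 + t * dir_deriv"
proof -
  note E = env_integrable[OF assms(2)]
  have h_nonneg: "AE x in M. 0 \<le> hinge \<tau> x" using hinge_bounds_AE by auto
  show "Lobj f xs (ray t) = ereal (L_ray t)"
    by (intro Lobj_ray integrable_exp_ray[OF _ _ h_nonneg order_refl E(1) env]) simp_all
  note bounds = exp_ray_integral_bounds[OF _ _ hinge_bounds_AE assms(1) E env]
  show "L_ray 0 + t * dir_deriv - t\<^sup>2 / 2 * (\<integral>x. x\<^sup>2 * env d x \<partial>M) \<le> L_ray t" "L_ray t \<le> L_ray 0 + t * dir_deriv"
    using bounds by (simp_all add: L_ray_def dir_deriv_def algebra_simps)
qed

lemma Lobj_\<theta>: "Lobj f xs \<theta> = ereal (L_ray 0)"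
  using ray_expansion(1)[OF order_refl _ exp_ray_le_env[OF order_refl improves_0 order_refl order_refl]]
    mR_less by (simp add: ray_0)

lemma ray_step:
  assumes "0 \<le> t" "improves t" "t \<le> s" "s \<le> t + \<delta>"
  shows "Lobj f xs (ray s) = ereal (L_ray s)"
    and "L_ray t - (s - t) * (\<integral>x. x * env \<delta> x \<partial>M) \<le> L_ray s"
proof -
  note E = env_integrable[OF \<delta>_less]
  note env = exp_ray_le_env[OF assms(1,2) less_imp_le[OF \<delta>_pos] assms(3,4)]
  have h_nonneg: "AE x in M. 0 \<le> hinge \<tau> x" using hinge_bounds_AE by auto
  show "Lobj f xs (ray s) = ereal (L_ray s)"
    by (intro Lobj_ray integrable_exp_ray[OF _ _ h_nonneg order_refl E(1) env]) simp_all
  have "(\<integral>x. exp (\<theta>e x + s * hinge \<tau> x) \<partial>M)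
      \<le> (\<integral>x. exp (\<theta>e x + t * hinge \<tau> x) \<partial>M) + (s - t) * (\<integral>x. x * env \<delta> x \<partial>M)"
    by (rule exp_ray_integral_step[OF _ _ hinge_bounds_AE assms(3) E(1,2) env]) simp_all
  moreover have "0 \<le> (s - t) * mean (hinge \<tau>)" using assms(3) mean_hinge_nonneg by simp
  ultimately show "L_ray t - (s - t) * (\<integral>x. x * env \<delta> x \<partial>M) \<le> L_ray s"
    by (simp add: L_ray_def algebra_simps)
qed

lemma DL_hinge: "DL f xs \<theta> (hinge \<tau>) = ereal dir_deriv"
proof -
  define C where "C = (\<integral>x. x\<^sup>2 * env \<delta> x \<partial>M) / 2"
  have expansion: "Lobj f xs (ray t) = ereal (L_ray t) \<and> L_ray 0 + t * dir_deriv - t\<^sup>2 * C \<le> L_ray t \<and> L_ray t \<le> L_ray 0 + t * dir_deriv"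
    if "0 < t" "t < \<delta>" for t
    using ray_expansion[OF _ \<delta>_less exp_ray_le_env[OF order_refl improves_0, of \<delta> t]] that
    by (simp add: C_def)
  have "((\<lambda>t. (L_ray t - L_ray 0) / t) \<longlongrightarrow> dir_deriv) (at_right 0)"
    using expansion by (intro quotient_tendsto_of_quadratic_bounds[OF \<delta>_pos]) blast
  then have lim: "((\<lambda>t. ereal ((L_ray t - L_ray 0) / t)) \<longlongrightarrow> ereal dir_deriv) (at_right 0)" by simp
  have "eventually (\<lambda>t. t \<in> {0<..<\<delta>}) (at_right 0)"
    using \<delta>_pos by (intro eventually_at_right_real)
  then have "eventually (\<lambda>t. ereal ((L_ray t - L_ray 0) / t) = (Lobj f xs (ray t) - Lobj f xs \<theta>) / ereal t) (at_right 0)"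
    by (rule eventually_mono) (simp add: expansion Lobj_\<theta>)
  with lim have "((\<lambda>t. (Lobj f xs (ray t) - Lobj f xs \<theta>) / ereal t) \<longlongrightarrow> ereal dir_deriv) (at_right 0)"
    by (rule Lim_transform_eventually)
  then show ?thesis unfolding DL_def ray_def[symmetric] by (intro tendsto_Lim) simp_all
qed

lemma improves_near_0:
  assumes "0 \<le> s" "s \<le> \<delta>" "s * (\<integral>x. x\<^sup>2 * env \<delta> x \<partial>M) \<le> 2 * dir_deriv"
  shows "improves s"
proof -
  note expansion = ray_expansion[OF assms(1) \<delta>_less exp_ray_le_env[OF order_refl improves_0 _ assms(1)]]
  have "s * (s * (\<integral>x. x\<^sup>2 * env \<delta> x \<partial>M)) \<le> s * (2 * dir_deriv)"
    using mult_left_mono[OF assms(3) assms(1)] .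
  then have "L_ray 0 \<le> L_ray 0 + s * dir_deriv - s\<^sup>2 / 2 * (\<integral>x. x\<^sup>2 * env \<delta> x \<partial>M)"
    by (simp add: power2_eq_square algebra_simps)
  also have "\<dots> \<le> L_ray s" using expansion(2) assms(2) \<delta>_pos by simp
  finally show ?thesis
    using expansion(1) assms(2) \<delta>_pos unfolding improves_def Lobj_\<theta> by simp
qed

lemma improves_step:
  assumes "0 \<le> t" "improves t" "t \<le> s" "s \<le> t + \<delta>"
    and "(s - t) * (\<integral>x. x * env \<delta> x \<partial>M) \<le> L_ray t - L_ray 0"
  shows "improves s"
  using ray_step[OF assms(1-4)] assms(5) unfolding improves_def Lobj_\<theta> by simp

lemma improving_ray_lower_bound:
  assumes "0 \<le> t" "improves t" "(\<integral>x. x\<^sup>2 * env 0 x \<partial>M) \<le> \<gamma>"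
  shows "Lobj f xs (ray t) = ereal (L_ray t)" "L_ray 0 + t * dir_deriv - t\<^sup>2 / 2 * \<gamma> \<le> L_ray t"
proof -
  note expansion = ray_expansion[OF assms(1) _ exp_ray_le_env[OF assms(1,2) order_refl order_refl]]
  show "Lobj f xs (ray t) = ereal (L_ray t)" using expansion(1) mR_less by simp
  have "t\<^sup>2 / 2 * (\<integral>x. x\<^sup>2 * env 0 x \<partial>M) \<le> t\<^sup>2 / 2 * \<gamma>"
    using assms(3) by (intro mult_left_mono) auto
  with expansion(2) mR_less show "L_ray 0 + t * dir_deriv - t\<^sup>2 / 2 * \<gamma> \<le> L_ray t" by simp
qed

lemma improving_ray_margin:
  assumes "0 \<le> t" "improves t" "(\<integral>x. x\<^sup>2 * env 0 x \<partial>M) \<le> \<gamma>" "0 < \<gamma>" "t \<le> dir_deriv / \<gamma>"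
  shows "t * dir_deriv / 2 \<le> L_ray t - L_ray 0"
proof -
  have "t * \<gamma> \<le> dir_deriv" using assms(4,5) by (simp add: le_divide_eq)
  then have "t\<^sup>2 / 2 * \<gamma> \<le> t * dir_deriv / 2"
    using mult_left_mono[of "t * \<gamma>" dir_deriv t] assms(1) by (simp add: power2_eq_square mult.assoc)
  with improving_ray_lower_bound(2)[OF assms(1-3)] show ?thesis by linarith
qed

text \<open>Membership in the superlevel set is propagated from \<open>[0, a]\<close> in steps of fixed length \<open>\<eta>\<close>:
  past \<open>a\<close> the quadratic bound keeps \<open>L_ray\<close> at least \<open>a D / 2\<close> above \<open>L_ray 0\<close>, which a step
  of length \<open>\<eta>\<close> cannot use up.\<close>

lemma improves_on_ray:
  assumes "0 < dir_deriv" "(\<integral>x. x\<^sup>2 * env 0 x \<partial>M) \<le> \<gamma>" "0 < \<gamma>" "0 \<le> t" "t \<le> dir_deriv / \<gamma>"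
  shows "improves t"
proof -
  define C1 where "C1 = (\<integral>x. x * env \<delta> x \<partial>M)"
  define C2 where "C2 = (\<integral>x. x\<^sup>2 * env \<delta> x \<partial>M)"
  have "0 \<le> C1" unfolding C1_def env_def
    using AE_dens_measure_nonneg[OF f_cont] by (intro integral_nonneg_AE) (auto elim!: eventually_mono)
  have "0 \<le> C2" unfolding C2_def env_def by (intro integral_nonneg_AE) auto
  define a where "a = min \<delta> (2 * dir_deriv / (C2 + 1))"
  have "0 < a" using \<delta>_pos assms(1) \<open>0 \<le> C2\<close> by (simp add: a_def)
  have initial: "improves s" if "0 \<le> s" "s \<le> a" for s
  proof (rule improves_near_0[OF that(1)])
    show "s \<le> \<delta>" using that by (simp add: a_def)
    have "s * C2 \<le> s * (C2 + 1)" using that(1) by (simp add: algebra_simps)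
    also have "\<dots> \<le> 2 * dir_deriv" using that \<open>0 \<le> C2\<close> by (simp add: a_def le_divide_eq)
    finally show "s * (\<integral>x. x\<^sup>2 * env \<delta> x \<partial>M) \<le> 2 * dir_deriv" by (simp add: C2_def)
  qed
  define \<eta> where "\<eta> = min \<delta> (a * dir_deriv / (2 * (C1 + 1)))"
  have "0 < \<eta>" using \<delta>_pos \<open>0 < a\<close> assms(1) \<open>0 \<le> C1\<close> by (simp add: \<eta>_def)
  have "\<eta> * C1 \<le> a * dir_deriv / 2"
  proof -
    have "\<eta> * C1 \<le> a * dir_deriv / (2 * (C1 + 1)) * (C1 + 1)"
      using \<open>0 \<le> C1\<close> \<open>0 < \<eta>\<close> by (intro mult_mono) (auto simp: \<eta>_def)
    also have "\<dots> = a * dir_deriv / 2" using \<open>0 \<le> C1\<close> by (simp add: field_simps)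
    finally show ?thesis .
  qed
  have step: "improves s" if "a \<le> t'" "t' \<le> dir_deriv / \<gamma>" "improves t'" "t' \<le> s" "s \<le> t' + \<eta>" for t' s
  proof (rule improves_step[OF _ that(3,4)])
    show "0 \<le> t'" "s \<le> t' + \<delta>" using that(1,5) \<open>0 < a\<close> by (auto simp: \<eta>_def)
    have "a * dir_deriv \<le> t' * dir_deriv" using that(1) assms(1) by simp
    moreover have "(s - t') * C1 \<le> \<eta> * C1" using that(4,5) \<open>0 \<le> C1\<close> by (intro mult_right_mono) auto
    ultimately show "(s - t') * (\<integral>x. x * env \<delta> x \<partial>M) \<le> L_ray t' - L_ray 0"
      using improving_ray_margin[OF \<open>0 \<le> t'\<close> that(3) assms(2,3) that(2)] \<open>\<eta> * C1 \<le> a * dir_deriv / 2\<close>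
      unfolding C1_def by linarith
  qed
  show ?thesis
  proof (cases "t \<le> a")
    case True
    with initial assms(4) show ?thesis by blast
  next
    case False
    with real_step_induct[where P = improves, OF \<open>0 < \<eta>\<close> initial[OF less_imp_le[OF \<open>0 < a\<close>] order_refl] step]
      assms(5) show ?thesis by auto
  qed
qed

lemma improvement_bound:
  assumes "0 < \<epsilon>" "\<epsilon> \<le> dir_deriv" "(\<integral>x. x\<^sup>2 * env 0 x \<partial>M) \<le> \<gamma>" "0 \<le> \<gamma>"
    and feasible: "\<And>t. 0 \<le> t \<Longrightarrow> Lobj f xs (ray t) \<le> L'"
  shows "ereal (\<epsilon>\<^sup>2 / (2 * \<gamma>)) \<le> L' - Lobj f xs \<theta>"
proof -
  have "ereal (L_ray 0 + \<epsilon>\<^sup>2 / (2 * \<gamma>)) \<le> L'"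
  proof (cases "\<gamma> = 0")
    case True
    then show ?thesis using feasible[of 0] by (simp add: ray_0 Lobj_\<theta>)
  next
    case False
    with assms(4) have "0 < \<gamma>" by simp
    define t where "t = dir_deriv / \<gamma>"
    have "0 \<le> t" using assms(1,2) \<open>0 < \<gamma>\<close> by (simp add: t_def)
    have "\<epsilon>\<^sup>2 / (2 * \<gamma>) \<le> dir_deriv\<^sup>2 / (2 * \<gamma>)"
      using assms(1,2) \<open>0 < \<gamma>\<close> by (intro divide_right_mono power_mono) auto
    also have "\<dots> = t * dir_deriv - t\<^sup>2 / 2 * \<gamma>"
      using \<open>0 < \<gamma>\<close> by (simp add: t_def power2_eq_square field_simps)
    finally have "ereal (L_ray 0 + \<epsilon>\<^sup>2 / (2 * \<gamma>)) \<le> Lobj f xs (ray t)"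
      using improving_ray_lower_bound[OF \<open>0 \<le> t\<close> improves_on_ray[OF _ assms(3) \<open>0 < \<gamma>\<close> \<open>0 \<le> t\<close>] assms(3)]
        assms(1,2) by (simp add: t_def)
    also have "\<dots> \<le> L'" using feasible[OF \<open>0 \<le> t\<close>] .
    finally show ?thesis .
  qed
  then show ?thesis unfolding Lobj_\<theta> by (cases L') auto
qed

lemma env_moment_le: "(\<integral>x. x\<^sup>2 * env 0 x \<partial>M) \<le> (\<integral>x. (x\<^sup>2 + c\<^sup>2) * exp (sR + mR * x) \<partial>M)"
proof -
  have "(\<integral>x. (x\<^sup>2 + c\<^sup>2) * exp (sR + mR * x) \<partial>M) = (\<integral>x. x\<^sup>2 * env 0 x \<partial>M) + c\<^sup>2 * (\<integral>x. env 0 x \<partial>M)"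
    using env_integrable[of 0] mR_less by (simp add: env_def[abs_def] distrib_right)
  moreover have "0 \<le> (\<integral>x. env 0 x \<partial>M)" by (simp add: env_def)
  ultimately show ?thesis by simp
qed

end

theorem mainTheorem2:
  fixes f :: "real \<Rightarrow> real" and \<beta> :: real and xs :: "real list"
    and \<epsilon> sR mR \<tau> :: real and \<theta>prev \<theta>new :: "real \<Rightarrow> real"
  assumes f_nonneg: "\<forall>x\<ge>0. f x \<ge> 0"
    and f_prob: "(\<integral>\<^sup>+ x. ennreal (indicator {0..} x * f x) \<partial>lborel) = 1"
    and A1_cont: "continuous_on {0..} f"
    and A1_pos: "\<forall>x>0. f x > 0"
    and A2: "\<forall>l::real. (\<integral>\<^sup>+ x. ennreal (exp (l * x)) \<partial>dens_measure f) < \<infinity> \<longleftrightarrow> l < \<beta>"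
    and A2_lim: "((\<lambda>l. \<integral>\<^sup>+ x. ennreal (exp (l * x)) \<partial>dens_measure f) \<longlongrightarrow> \<infinity>) (at_left \<beta>)"
    and A3: "\<forall>l::real. (\<integral>\<^sup>+ x. ennreal (exp (l * x)) \<partial>dens_measure f) < \<infinity> \<longrightarrow>
               (\<integral>\<^sup>+ x. ennreal (x\<^sup>2 * exp (l * x)) \<partial>dens_measure f) < \<infinity>"
    and data_ne: "xs \<noteq> []"
    and data_sorted: "sorted xs"
    and data_nonneg: "\<forall>x\<in>set xs. x \<ge> 0"
    and eps_pos: "\<epsilon> > 0"
    and prev_mem: "\<theta>prev \<in> Theta \<inter> PL"
    and tau_nonneg: "\<tau> \<ge> 0"
    and tau_max: "\<forall>\<tau>'\<ge>0. DL f xs \<theta>prev (hinge \<tau>') \<le> DL f xs \<theta>prev (hinge \<tau>)"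
    and new_mem: "\<theta>new \<in> Theta \<inter> PL_on (breakpoints \<theta>prev \<union> {\<tau>})"
    and new_max: "\<forall>\<theta>\<in>Theta \<inter> PL_on (breakpoints \<theta>prev \<union> {\<tau>}). Lobj f xs \<theta> \<le> Lobj f xs \<theta>new"
    and R_finite: "\<bar>Lobj f xs \<theta>prev\<bar> \<noteq> \<infinity>"
    and sR_nonneg: "sR \<ge> 0"
    and mR_lt: "mR < \<beta>"
    and sR_mR_bound: "\<forall>\<phi>\<in>Theta. Lobj f xs \<phi> \<ge> Lobj f xs \<theta>prev \<longrightarrow>
          \<bar>\<phi> 0\<bar> \<le> sR \<and> (SUP x\<in>{0..}. right_deriv \<phi> x) \<le> mR"
    and sup_ge: "(SUP \<tau>'\<in>{0..}. DL f xs \<theta>prev (hinge \<tau>')) \<ge> ereal \<epsilon>"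
  shows "Lobj f xs \<theta>new - Lobj f xs \<theta>prev \<ge>
           ereal (\<epsilon>\<^sup>2 / (2 * (\<integral>x. (x\<^sup>2 + (last xs)\<^sup>2) * exp (sR + mR * x) \<partial>dens_measure f)))"
proof -
  have exp_moments: "integrable (dens_measure f) (\<lambda>x. exp (l * x)) \<and>
      integrable (dens_measure f) (\<lambda>x. x\<^sup>2 * exp (l * x))" if "l < \<beta>" for l
    using A2 A3 that by (auto simp: integrable_iff_bounded abs_mult)
  interpret hinge_line_search f \<beta> xs sR mR \<tau> \<theta>prev
    using A1_cont exp_moments data_nonneg prev_mem tau_nonneg mR_lt sR_mR_bound by unfold_locales auto
  have "ereal \<epsilon> \<le> ereal dir_deriv"
    using sup_ge tau_max DL_hinge by (metis (no_types, lifting) SUP_least atLeast_iff order_trans)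
  then show ?thesis
    using eps_pos env_moment_le new_max ray_mem by (intro improvement_bound) auto
qed

end
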